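(* Let $S\subseteq\{1,2,\ldots,n\}$. Then for $1\le i<l\le n$ and $a\in\mathbb{F}_q^\times$, the restriction $\mathrm{Res}^{U_n}_{U_S}(\chi^{\langle i\overset{a}{\frown} l\rangle_n})$ is equal to: (1) if $i,l\in S$: $$q^{|\{i<k<l\,\mid\, k\notin S\}|}\,\chi^{\langle i\overset{a}{\frown} l\rangle_S};$$ (2) if $i\notin S$, $l\in S$: $$q^{|\{i<k<l\,\mid\, k\notin S\}|}\Big(\mathbf 1+\sum_{i<j<l,\ j\in S}\ \sum_{b\in\mathbb{F}_q^\times}\chi^{\langle j\overset{b}{\frown} l\rangle_S}\Big);$$ (3) if $i\in S$, $l\notin S$: $$q^{|\{i<k<l\,\mid\, k\notin S\}|}\Big(\mathbf 1+\sum_{i<k<l,\ k\in S}\ \sum_{b\in\mathbb{F}_q^\times}\chi^{\langle i\overset{b}{\frown} k\rangle_S}\Big);$$ (4) if $i,l\notin S$: $$q^{|\{i<k'<l\,\mid\, k'\notin S\}|}\Big(\big(|S\cap[i,l]|(q-1)+1\big)\mathbf 1+(q-1)\sum_{\substack{i<j'<k'<l\\ j',k'\in S}}\ \sum_{c\in\mathbb{F}_q^\times}\chi^{\langle j'\overset{c}{\frown} k'\rangle_S}\Big).$$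
   Context: Let $q$ be a power of a prime and let $U_n=U_n(q)$ be the group of $n\times n$ unipotent upper-triangular matrices over $\mathbb{F}_q$. Fix a nontrivial homomorphism $\vartheta:\mathbb{F}_q^+\to\mathbb{C}^\times$. For a subset $S\subseteq\{1,\ldots,n\}$ let $U_S=\{u\in U_n\mid \text{for } i<j,\ u_{ij}\ne0 \text{ implies } i,j\in S\}$, a subgroup of $U_n$, and let $\mathfrak n_S=\{u-1\mid u\in U_S\}$; write $\mathfrak n_n=\mathfrak n_{\{1,\ldots,n\}}$. Also $[i,l]=\{i,i+1,\ldots,l\}$. The group $U_S$ acts on the left and on the right on the dual space $\mathfrak n_S^*$ by $(g\lambda)(X)=\lambda(g^{-1}X)$ and $(\lambda g)(X)=\lambda(Xg^{-1})$. For $\lambda\in\mathfrak n_S^*$ the supercharacter $\chi^\lambda$ of $U_S$ is $$\chi^\lambda(u)=\frac{|\lambda U_S|}{|U_S\lambda U_S|}\sum_{\mu\in U_S\lambda U_S}\vartheta(\mu(u-1)),\qquad u\in U_S.$$ For $i<l$ in $S$ and $a\in\mathbb{F}_q^\times$, $\langle i\overset{a}{\frown} l\rangle_S$ denotes the $\mathbb{F}_q$-labeled set-partition of $S$ whose only arc is $i\overset{a}{\frown} l$ (i.e. $i,l$ form one part, all other parts are singletons, and the arc from $i$ to $l$ is labeled by $a$). It is identified with the functional $X\mapsto aX_{il}$ on $\mathfrak n_S$, so that $\chi^{\langle i\overset{a}{\frown} l\rangle_S}$ is a supercharacter of $U_S$. We write $\langle i\overset{a}{\frown} l\rangle_n$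 for $S=\{1,\ldots,n\}$, giving a supercharacter of $U_n$. $\mathbf 1$ is the trivial character of $U_S$, and $\mathrm{Res}$ denotes restriction of functions. *)

theory Defs
  imports "Jordan_Normal_Form.Determinant"
begin

text \<open>The field with \<open>q\<close> elements is a type of class \<open>{field,finite}\<close>. Rows and columns carry the
  labels \<open>1, \<dots>, n\<close>, while the indices of \<^typ>\<open>'a mat\<close> start at 0; \<open>entry\<close> mediates between
  the two and is only used for labels in \<open>{1..n}\<close>.\<close>

definition entry :: "'a mat \<Rightarrow> nat \<Rightarrow> nat \<Rightarrow> 'a" where
  "entry A i j = A $$ (i - 1, j - 1)"

definition unitriangular :: "nat \<Rightarrow> 'a::field mat set" where
  "unitriangular n = {u \<in> carrier_mat n n. upper_triangular u \<and> (\<forall>i\<in>{1..n}. entry u i i = 1)}"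

definition U :: "nat \<Rightarrow> nat set \<Rightarrow> 'a::field mat monoid" where
  "U n S = \<lparr>carrier = {u \<in> unitriangular n.
              \<forall>i\<in>{1..n}. \<forall>j\<in>{1..n}. i < j \<longrightarrow> entry u i j \<noteq> 0 \<longrightarrow> i \<in> S \<and> j \<in> S},
            mult = (*), one = 1\<^sub>m n\<rparr>"

definition nil :: "nat \<Rightarrow> nat set \<Rightarrow> 'a::field mat set" where
  "nil n S = {u - 1\<^sub>m n |u. u \<in> carrier (U n S)}"

text \<open>Functionals on \<open>nil n S\<close> are represented by extensional functions (\<open>undefined\<close> outside
  \<open>nil n S\<close>), so that distinct functions in the dual are distinct functionals and the cardinalities
  of orbits are the intended ones. The same convention is used for functions on \<open>U n S\<close>.\<close>

definition nil_dual :: "nat \<Rightarrow> nat set \<Rightarrow> ('a::field mat \<Rightarrow> 'a) set" where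
  "nil_dual n S = {\<phi> \<in> extensional (nil n S).
     (\<forall>X\<in>nil n S. \<forall>Y\<in>nil n S. \<phi> (X + Y) = \<phi> X + \<phi> Y) \<and>
     (\<forall>c. \<forall>X\<in>nil n S. \<phi> (c \<cdot>\<^sub>m X) = c * \<phi> X)}"

definition left_act :: "nat \<Rightarrow> nat set \<Rightarrow> 'a::field mat \<Rightarrow> ('a mat \<Rightarrow> 'a) \<Rightarrow> 'a mat \<Rightarrow> 'a" where
  "left_act n S g \<phi> = (\<lambda>X\<in>nil n S. \<phi> (inv\<^bsub>U n S\<^esub> g * X))"

definition right_act :: "nat \<Rightarrow> nat set \<Rightarrow> ('a::field mat \<Rightarrow> 'a) \<Rightarrow> 'a mat \<Rightarrow> 'a mat \<Rightarrow> 'a" where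
  "right_act n S \<phi> g = (\<lambda>X\<in>nil n S. \<phi> (X * inv\<^bsub>U n S\<^esub> g))"

definition right_orbit :: "nat \<Rightarrow> nat set \<Rightarrow> ('a::field mat \<Rightarrow> 'a) \<Rightarrow> ('a mat \<Rightarrow> 'a) set" where
  "right_orbit n S \<phi> = {right_act n S \<phi> g |g. g \<in> carrier (U n S)}"

definition two_sided_orbit :: "nat \<Rightarrow> nat set \<Rightarrow> ('a::field mat \<Rightarrow> 'a) \<Rightarrow> ('a mat \<Rightarrow> 'a) set" where
  "two_sided_orbit n S \<phi> =
     {right_act n S (left_act n S g \<phi>) h |g h. g \<in> carrier (U n S) \<and> h \<in> carrier (U n S)}"

definition nontrivial_additive_character :: "('a::field \<Rightarrow> complex) \<Rightarrow> bool" where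
  "nontrivial_additive_character \<theta> \<longleftrightarrow>
     (\<forall>x y. \<theta> (x + y) = \<theta> x * \<theta> y) \<and> (\<forall>x. \<theta> x \<noteq> 0) \<and> (\<exists>x. \<theta> x \<noteq> 1)"

definition supercharacter ::
    "('a::field \<Rightarrow> complex) \<Rightarrow> nat \<Rightarrow> nat set \<Rightarrow> ('a mat \<Rightarrow> 'a) \<Rightarrow> 'a mat \<Rightarrow> complex" where
  "supercharacter \<theta> n S \<phi> = (\<lambda>u\<in>carrier (U n S).
     of_nat (card (right_orbit n S \<phi>)) / of_nat (card (two_sided_orbit n S \<phi>)) *
     (\<Sum>\<mu>\<in>two_sided_orbit n S \<phi>. \<theta> (\<mu> (u - 1\<^sub>m n))))"

text \<open>The labeled set partition of \<open>S\<close> whose only arc joins \<open>i\<close> to \<open>l\<close> and has label \<open>a\<close>,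
  identified with its functional.\<close>

definition arc :: "nat \<Rightarrow> nat set \<Rightarrow> nat \<Rightarrow> 'a::field \<Rightarrow> nat \<Rightarrow> 'a mat \<Rightarrow> 'a" where
  "arc n S i a l = (\<lambda>X\<in>nil n S. a * entry X i l)"

lemma mem_nil_iff:
  "X \<in> nil n S \<longleftrightarrow> X \<in> carrier_mat n n \<and>
     (\<forall>i\<in>{1..n}. \<forall>j\<in>{1..n}. entry X i j \<noteq> 0 \<longrightarrow> i < j \<and> i \<in> S \<and> j \<in> S)" (is "?L \<longleftrightarrow> ?R")
proof
  assume ?L
  then obtain u where u: "u \<in> carrier (U n S)" and X: "X = u - 1\<^sub>m n" unfolding nil_def by blast
  have c: "u \<in> carrier_mat n n" using u by (simp add: U_def unitriangular_def)
  have "i < j \<and> i \<in> S \<and> j \<in> S"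
    if i: "i \<in> {1..n}" and j: "j \<in> {1..n}" and nz: "entry X i j \<noteq> 0" for i j
  proof -
    have e: "entry X i j = entry u i j - (if i = j then 1 else 0)"
      using i j c unfolding X entry_def by auto
    have "i \<noteq> j" using e nz u i by (auto simp: U_def unitriangular_def)
    moreover have "\<not> j < i"
    proof
      assume "j < i"
      then have "j - 1 < i - 1" "i - 1 < dim_row u" using i j c by auto
      moreover have "upper_triangular u" using u by (simp add: U_def unitriangular_def)
      ultimately have "entry u i j = 0" unfolding entry_def by (simp add: upper_triangular_def)
      then show False using e nz \<open>i \<noteq> j\<close> by simp
    qed
    ultimately have "i < j" by simp
    moreover have "\<forall>i\<in>{1..n}. \<forall>j\<in>{1..n}. i < j \<longrightarrow> entry u i j \<noteq> 0 \<longrightarrow> i \<in> S \<and> j \<in> S"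
      using u unfolding U_def by simp
    moreover have "entry u i j \<noteq> 0" using e nz \<open>i \<noteq> j\<close> by simp
    ultimately show ?thesis using i j by blast
  qed
  then show ?R using c X by (auto intro: minus_carrier_mat)
next
  assume R: ?R
  then have c: "X \<in> carrier_mat n n" by blast
  define u where "u = X + 1\<^sub>m n"
  have cu: "u \<in> carrier_mat n n" using c unfolding u_def by simp
  have e: "entry u i j = entry X i j + (if i = j then 1 else 0)"
    if "i \<in> {1..n}" "j \<in> {1..n}" for i j
    using that c unfolding u_def entry_def by auto
  have "upper_triangular u"
  proof (rule upper_triangularI)
    fix i j assume ij: "j < i" "i < dim_row u"
    then have r: "Suc i \<in> {1..n}" "Suc j \<in> {1..n}" using cu by auto
    have "entry X (Suc i) (Suc j) = 0" using R r ij(1) by force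
    then have "entry u (Suc i) (Suc j) = 0" using e[OF r] ij by simp
    then show "u $$ (i, j) = 0" by (simp add: entry_def)
  qed
  moreover have "entry u i i = 1" if "i \<in> {1..n}" for i using e[OF that that] R that by force
  ultimately have "u \<in> carrier (U n S)" using cu e R by (auto simp: U_def unitriangular_def)
  moreover have "X = u - 1\<^sub>m n" unfolding u_def using c by (intro eq_matI) auto
  ultimately show ?L unfolding nil_def by blast
qed

lemma arc_in_nil_dual:
  assumes "1 \<le> i" "i < l" "l \<le> n"
  shows "arc n S i a l \<in> nil_dual n S"
proof -
  have il: "i - 1 < n" "l - 1 < n" using assms by auto
  have ea: "entry (X + Y) j k = entry X j k + entry Y j k"
    if "X \<in> nil n S" "Y \<in> nil n S" "j \<in> {1..n}" "k \<in> {1..n}" for X Y :: "'a mat" and j k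
    using that unfolding entry_def mem_nil_iff by auto
  have em: "entry (c \<cdot>\<^sub>m X) j k = c * entry X j k"
    if "X \<in> nil n S" "j \<in> {1..n}" "k \<in> {1..n}" for X :: "'a mat" and c j k
    using that unfolding entry_def mem_nil_iff by auto
  have pa: "X + Y \<in> nil n S" if XY: "X \<in> nil n S" "Y \<in> nil n S" for X Y :: "'a mat"
    unfolding mem_nil_iff
  proof (intro conjI ballI impI)
    show "X + Y \<in> carrier_mat n n" using XY by (auto simp: mem_nil_iff)
  next
    fix j k assume jk: "j \<in> {1..n}" "k \<in> {1..n}" "entry (X + Y) j k \<noteq> 0"
    have "entry X j k \<noteq> 0 \<or> entry Y j k \<noteq> 0" using ea[OF XY jk(1,2)] jk(3) by auto
    then show "j < k" "j \<in> S" "k \<in> S" using XY jk(1,2) unfolding mem_nil_iff by blast+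
  qed
  have pm: "c \<cdot>\<^sub>m X \<in> nil n S" if X: "X \<in> nil n S" for X :: "'a mat" and c
    unfolding mem_nil_iff
  proof (intro conjI ballI impI)
    show "c \<cdot>\<^sub>m X \<in> carrier_mat n n" using X by (auto simp: mem_nil_iff)
  next
    fix j k assume jk: "j \<in> {1..n}" "k \<in> {1..n}" "entry (c \<cdot>\<^sub>m X) j k \<noteq> 0"
    have "entry X j k \<noteq> 0" using em[OF X jk(1,2)] jk(3) by auto
    then show "j < k" "j \<in> S" "k \<in> S" using X jk(1,2) unfolding mem_nil_iff by blast+
  qed
  show ?thesis
    using assms pa pm unfolding nil_dual_def arc_def by (auto simp: ea em distrib_left)
qed

lemma mem_U_iff: "u \<in> carrier (U n S) \<longleftrightarrow> u \<in> carrier_mat n n \<and> u - 1\<^sub>m n \<in> nil n S"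
proof
  assume u: "u \<in> carrier (U n S)"
  then show "u \<in> carrier_mat n n \<and> u - 1\<^sub>m n \<in> nil n S"
    unfolding nil_def by (auto simp: U_def unitriangular_def)
next
  assume u: "u \<in> carrier_mat n n \<and> u - 1\<^sub>m n \<in> nil n S"
  then obtain v where v: "v \<in> carrier (U n S)" "u - 1\<^sub>m n = v - 1\<^sub>m n" unfolding nil_def by blast
  have "v \<in> carrier_mat n n" using v by (simp add: U_def unitriangular_def)
  then have "u = v"
    using u arg_cong[OF v(2), of "\<lambda>A. A + 1\<^sub>m n"] by (auto simp: mat_eq_iff)
  then show "u \<in> carrier (U n S)" using v by simp
qed

lemma U_group: "group (U n S :: 'a::{field,finite} mat monoid)"
proof -
  let ?C = "carrier (U n S :: 'a mat monoid)"
  have cc: "u \<in> carrier_mat n n" if "u \<in> ?C" for u using that by (simp add: mem_U_iff)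
  have nil_add: "X + Y \<in> nil n S" if XY: "X \<in> nil n S" "Y \<in> nil n S" for X Y :: "'a mat"
    unfolding mem_nil_iff
  proof (intro conjI ballI impI)
    show "X + Y \<in> carrier_mat n n" using XY by (auto simp: mem_nil_iff)
  next
    fix j k assume jk: "j \<in> {1..n}" "k \<in> {1..n}" "entry (X + Y) j k \<noteq> 0"
    have "entry (X + Y) j k = entry X j k + entry Y j k"
      using XY jk unfolding entry_def mem_nil_iff by auto
    then have "entry X j k \<noteq> 0 \<or> entry Y j k \<noteq> 0" using jk(3) by auto
    then show "j < k" "j \<in> S" "k \<in> S" using XY jk(1,2) unfolding mem_nil_iff by blast+
  qed
  have nil_mult: "X * Y \<in> nil n S" if XY: "X \<in> nil n S" "Y \<in> nil n S" for X Y :: "'a mat"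
  proof -
    have c: "X \<in> carrier_mat n n" "Y \<in> carrier_mat n n" using XY by (auto simp: mem_nil_iff)
    have "j < k \<and> j \<in> S \<and> k \<in> S"
      if jk: "j \<in> {1..n}" "k \<in> {1..n}" "entry (X * Y) j k \<noteq> 0" for j k
    proof -
      have "entry (X * Y) j k = (\<Sum>m<n. X $$ (j - 1, m) * Y $$ (m, k - 1))"
        using c jk unfolding entry_def by (auto simp: scalar_prod_def lessThan_atLeast0)
      then obtain m where m: "m < n" "X $$ (j - 1, m) * Y $$ (m, k - 1) \<noteq> 0"
        using jk(3) by (metis (no_types, lifting) lessThan_iff sum.neutral)
      then have "entry X j (Suc m) \<noteq> 0" "entry Y (Suc m) k \<noteq> 0" "Suc m \<in> {1..n}"
        by (auto simp: entry_def)
      then have "j < Suc m \<and> j \<in> S" "Suc m < k \<and> k \<in> S"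
        using XY jk(1,2) unfolding mem_nil_iff by blast+
      then show ?thesis by auto
    qed
    then show ?thesis using c unfolding mem_nil_iff by auto
  qed
  have closed: "u * v \<in> ?C" if "u \<in> ?C" "v \<in> ?C" for u v
  proof -
    define X Y where "X = u - 1\<^sub>m n" and "Y = v - 1\<^sub>m n"
    have XY: "X \<in> nil n S" "Y \<in> nil n S" using that by (auto simp: mem_U_iff X_def Y_def)
    have c: "X \<in> carrier_mat n n" "Y \<in> carrier_mat n n" "u \<in> carrier_mat n n" "v \<in> carrier_mat n n"
      using XY that by (auto simp: mem_nil_iff mem_U_iff)
    have uv: "u = X + 1\<^sub>m n" "v = Y + 1\<^sub>m n" using c by (auto simp: X_def Y_def)
    have cXY: "X * Y \<in> carrier_mat n n" using c by simp
    have "u * v = X * (Y + 1\<^sub>m n) + 1\<^sub>m n * (Y + 1\<^sub>m n)"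
      unfolding uv using c by (intro add_mult_distrib_mat) auto
    also have "X * (Y + 1\<^sub>m n) = X * Y + X * 1\<^sub>m n"
      using c by (intro mult_add_distrib_mat) auto
    finally have "u * v = (X * Y + X) + (Y + 1\<^sub>m n)" using c by simp
    then have "u * v - 1\<^sub>m n = (X * Y + X) + Y"
      using c cXY by (auto simp: mat_eq_iff)
    then show ?thesis using c XY nil_add nil_mult by (auto simp: mem_U_iff)
  qed
  have one: "1\<^sub>m n \<in> ?C" by (auto simp: mem_U_iff mem_nil_iff entry_def)
  have fin: "finite ?C"
  proof (rule finite_subset)
    show "?C \<subseteq> (\<lambda>f. mat n n f) ` ({0..<n} \<times> {0..<n} \<rightarrow>\<^sub>E UNIV)"
    proof
      fix u assume "u \<in> ?C"
      then have "u \<in> carrier_mat n n" by (rule cc)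
      then have "u = mat n n (restrict (($$) u) ({0..<n} \<times> {0..<n}))"
        by (intro eq_matI) auto
      then show "u \<in> (\<lambda>f. mat n n f) ` ({0..<n} \<times> {0..<n} \<rightarrow>\<^sub>E UNIV)"
        by (rule image_eqI[where f = "mat n n"]) auto
    qed
    show "finite ((\<lambda>f. mat n n f) ` (({0..<n} \<times> {0..<n} \<rightarrow>\<^sub>E UNIV) :: (nat \<times> nat \<Rightarrow> 'a) set))"
      by (intro finite_imageI finite_PiE) auto
  qed
  have inj: "x = y" if g: "g \<in> ?C" "x \<in> ?C" "y \<in> ?C" and e: "x * g = y * g" for g x y
  proof -
    have cg: "g \<in> carrier_mat n n" using g cc by blast
    have "upper_triangular g" "\<forall>i\<in>{1..n}. entry g i i = 1"
      using g(1) by (auto simp: U_def unitriangular_def)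
    then have d: "diag_mat g = map (\<lambda>_. 1) [0..<n]"
      using cg unfolding diag_mat_def entry_def by (auto dest!: bspec[of _ _ "Suc _"])
    have "det g = 1"
      using det_upper_triangular[OF \<open>upper_triangular g\<close> cg] unfolding d by (simp add: map_replicate_const)
    then have "g \<in> Units (ring_mat TYPE('a) n ())" using det_non_zero_imp_unit[OF cg] by simp
    then obtain h where h: "h \<in> carrier_mat n n" "g * h = 1\<^sub>m n"
      unfolding Units_def ring_mat_def by auto
    have "x = x * (g * h)" "y = y * (g * h)" using cc[OF g(2)] cc[OF g(3)] by (simp_all add: h(2))
    moreover have "x * (g * h) = (x * g) * h" "y * (g * h) = (y * g) * h"
      using assoc_mult_mat[OF cc[OF g(2)] cg h(1)] assoc_mult_mat[OF cc[OF g(3)] cg h(1)] by simp_all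
    ultimately show ?thesis using e by simp
  qed
  have mult: "mult (U n S) = ((*) :: 'a mat \<Rightarrow> _)" and one_eq: "one (U n S) = (1\<^sub>m n :: 'a mat)"
    by (simp_all add: U_def)
  show ?thesis
  proof (rule groupI, unfold mult one_eq)
    fix g assume g: "g \<in> ?C"
    have "inj_on (\<lambda>x. x * g) ?C" using inj[OF g] by (auto intro: inj_onI)
    moreover have "(\<lambda>x. x * g) ` ?C \<subseteq> ?C" using closed g by blast
    ultimately have "(\<lambda>x. x * g) ` ?C = ?C" using endo_inj_surj[OF fin] by blast
    then have "1\<^sub>m n \<in> (\<lambda>x. x * g) ` ?C" using one by simp
    then obtain h where "h \<in> ?C" "1\<^sub>m n = h * g" by (rule imageE)
    then show "\<exists>h\<in>?C. h * g = 1\<^sub>m n" by (intro bexI[of _ h]) simp_all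
  next
    fix x y z assume "x \<in> ?C" "y \<in> ?C" "z \<in> ?C"
    then show "x * y * z = x * (y * z)" by (intro assoc_mult_mat[of _ n n _ n _ n] cc)
  next show "1\<^sub>m n \<in> ?C" by (rule one)
next fix x assume "x \<in> ?C" then show "1\<^sub>m n * x = x" using cc[of x] by simp
next fix x y assume "x \<in> ?C" "y \<in> ?C" then show "x * y \<in> ?C" by (rule closed)
qed
qed

lemma U_subgroup:
  assumes "S \<subseteq> {1..n}"
  shows "subgroup (carrier (U n S)) (U n {1..n} :: 'a::{field,finite} mat monoid)"
proof -
  let ?G = "U n {1..n} :: 'a mat monoid" and ?H = "U n S :: 'a mat monoid"
  interpret G: group ?G by (rule U_group)
  interpret H: group ?H by (rule U_group)
  have sub: "carrier ?H \<subseteq> carrier ?G" by (auto simp: U_def)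
  have same: "mult ?G = mult ?H" "one ?G = one ?H" by (simp_all add: U_def)
  show ?thesis
  proof (rule G.subgroupI)
    fix x assume x: "x \<in> carrier ?H"
    have "inv\<^bsub>?G\<^esub> x = inv\<^bsub>?H\<^esub> x"
    proof (rule G.inv_equality)
      show "inv\<^bsub>?H\<^esub> x \<otimes>\<^bsub>?G\<^esub> x = \<one>\<^bsub>?G\<^esub>" unfolding same using x by (rule H.l_inv)
    qed (use x sub in \<open>auto intro: H.inv_closed\<close>)
    then show "inv\<^bsub>?G\<^esub> x \<in> carrier ?H" using x by simp
  next
    fix x y assume "x \<in> carrier ?H" "y \<in> carrier ?H"
    then show "x \<otimes>\<^bsub>?G\<^esub> y \<in> carrier ?H" unfolding same by (rule H.m_closed)
  next
    show "carrier ?H \<noteq> {}" using H.one_closed by blast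
  qed (rule sub)
qed

end

theory Submission
  imports Defs
begin

text \<open>The supercharacter of a single arc is an explicit exponential sum. Let \<open>K\<close> be the set of
  labels of \<open>S\<close> strictly between \<open>i\<close> and \<open>l\<close>. Suppose that \<open>i\<close> and \<open>l\<close> are in \<open>S\<close>.
  For \<open>g\<close> and \<open>h\<close> in the group, the entry of \<open>gXh\<close> at \<open>(i, l)\<close> involves only the row \<open>i\<close> of \<open>g\<close> and the column \<open>l\<close> of \<open>h\<close>, and their entries at the
  labels of \<open>K\<close> are arbitrary. Hence the two-sided orbit of the arc is parametrised by pairs of
  vectors \<open>x, y\<close> indexed by \<open>K\<close>, through
  \<open>X \<mapsto> a * (\<Sum>j k. x\<^sub>j * X\<^sub>j\<^sub>k * y\<^sub>k)\<close> with \<open>x\<^sub>i = y\<^sub>l = 1\<close>, and the right orbit is the part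
  \<open>x = 0\<close> on \<open>K\<close>. Evaluation at elementary matrices shows that the parametrisation is injective,
  so the supercharacter is the sum of \<open>\<theta>\<close> over all these pairs, divided by \<open>q ^ |K|\<close>
  (\<open>supercharacter_arc\<close>).

  On \<open>U\<^sub>S\<close> the rows and columns of \<open>X = u - 1\<close> outside \<open>S\<close> vanish. Each \<open>k\<close> outside \<open>S\<close> between
  \<open>i\<close> and \<open>l\<close> then contributes two free summation variables and one factor \<open>q\<close> to the denominator,
  so it can be dropped at the cost of a factor \<open>q\<close> (\<open>arc_sum_Un_zero\<close>). What remains is the same
  kind of sum over \<open>K\<close>. If \<open>i\<close> and \<open>l\<close> are in \<open>S\<close>, it is the supercharacter of the same arc of \<open>S\<close>.

  If \<open>i\<close> is outside \<open>S\<close>, row \<open>i\<close> of \<open>X\<close> vanishes and \<open>x\<close> can be sorted by its first nonzero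
  position \<open>j\<close>: after scaling \<open>x\<^sub>j\<close> to 1, these \<open>x\<close> make up the exponential sums of the arcs from
  \<open>j\<close> to \<open>l\<close>, one for each nonzero label, and \<open>x = 0\<close> gives the trivial character
  (\<open>arc_sum_expand_row\<close>). The exponential sum is invariant under transposition of \<open>X\<close> together
  with exchange of \<open>i\<close> and \<open>l\<close>, so the case of \<open>l\<close> outside \<open>S\<close> is the mirror image
  (\<open>arc_sum_expand_col\<close>). If both endpoints are outside \<open>S\<close>, the row expansion leads to arcs
  ending at \<open>l\<close>, to which the column expansion applies. Each of the \<open>|K| * (q - 1)\<close> arcs of the
  first expansion then contributes one trivial character, and the \<open>q - 1\<close> labels at each \<open>j\<close>
  contribute equally, which accounts for the multiplicities in the last formula.\<close>

section \<open>The exponential sum of an arc\<close>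

text \<open>For \<open>i\<close> and \<open>l\<close> outside \<open>K\<close>, this is the sum of \<open>x j * X j k * y k\<close> over \<open>j\<close> in \<open>insert i K\<close>
  and \<open>k\<close> in \<open>insert l K\<close>, with \<open>x i\<close> and \<open>y l\<close> replaced by 1. The four parts
  are written separately, so that \<open>x\<close> and \<open>y\<close> are independent functions on \<open>K\<close> alone.\<close>

definition arc_form ::
    "(nat \<Rightarrow> nat \<Rightarrow> 'a::comm_ring_1) \<Rightarrow> nat \<Rightarrow> nat \<Rightarrow> nat set \<Rightarrow> (nat \<Rightarrow> 'a) \<Rightarrow> (nat \<Rightarrow> 'a) \<Rightarrow> 'a" where
  "arc_form X i l K x y =
     X i l + (\<Sum>k\<in>K. X i k * y k) + (\<Sum>j\<in>K. x j * X j l) + (\<Sum>j\<in>K. \<Sum>k\<in>K. x j * X j k * y k)"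

text \<open>The normalisation \<open>q ^ card K\<close> is the ratio of the two orbit sizes in the definition of a
  supercharacter.\<close>

definition arc_sum ::
    "('a::{field,finite} \<Rightarrow> complex) \<Rightarrow> (nat \<Rightarrow> nat \<Rightarrow> 'a) \<Rightarrow> nat \<Rightarrow> nat \<Rightarrow> nat set \<Rightarrow> 'a \<Rightarrow> complex" where
  "arc_sum \<theta> X i l K a =
     (\<Sum>x\<in>K \<rightarrow>\<^sub>E UNIV. \<Sum>y\<in>K \<rightarrow>\<^sub>E UNIV. \<theta> (a * arc_form X i l K x y)) /
     of_nat (card (UNIV :: 'a set)) ^ card K"

lemma sum_PiE_insert:
  assumes "m \<notin> K"
  shows "(\<Sum>x\<in>insert m K \<rightarrow>\<^sub>E UNIV. f x) = (\<Sum>b\<in>UNIV. \<Sum>x\<in>K \<rightarrow>\<^sub>E UNIV. f (x(m := b)))"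
proof -
  have "(\<Sum>x\<in>insert m K \<rightarrow>\<^sub>E UNIV. f x) =
      (\<Sum>p\<in>UNIV \<times> (K \<rightarrow>\<^sub>E UNIV). f ((\<lambda>(b, x). x(m := b)) p))"
    unfolding PiE_insert_eq using assms
    by (subst sum.reindex) (auto intro: inj_combinator)
  then show ?thesis by (simp add: sum.cartesian_product case_prod_unfold)
qed

lemma sum_PiE_insert2:
  assumes "m \<notin> K"
  shows "(\<Sum>x\<in>insert m K \<rightarrow>\<^sub>E UNIV. \<Sum>y\<in>insert m K \<rightarrow>\<^sub>E UNIV. f x y) =
    (\<Sum>b\<in>UNIV. \<Sum>c\<in>UNIV. \<Sum>x\<in>K \<rightarrow>\<^sub>E UNIV. \<Sum>y\<in>K \<rightarrow>\<^sub>E UNIV. f (x(m := b)) (y(m := c)))"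
  unfolding sum_PiE_insert[OF assms] by (intro sum.cong refl sum.swap)

lemma arc_form_insert:
  fixes X :: "nat \<Rightarrow> nat \<Rightarrow> 'a::comm_ring_1"
  assumes "finite K" and "m \<notin> K"
  shows "arc_form X i l (insert m K) (x(m := b)) (y(m := c)) =
    arc_form X i l K x y + X i m * c + b * (X m l + (\<Sum>k\<in>K. X m k * y k)) +
    (\<Sum>j\<in>K. x j * X j m) * c + b * X m m * c"
proof -
  have upd: "(f(m := d)) k = f k" if "k \<in> K" for f :: "nat \<Rightarrow> 'a" and d k
    using that assms(2) by auto
  show ?thesis
    unfolding arc_form_def using assms
    by (simp add: upd sum.distrib sum_distrib_left sum_distrib_right algebra_simps
        del: fun_upd_apply add: fun_upd_same cong: sum.cong)
qed

lemma arc_sum_transpose: "arc_sum \<theta> X i l K a = arc_sum \<theta> (\<lambda>j k. X k j) l i K a"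
proof -
  have "arc_form X i l K x y = arc_form (\<lambda>j k. X k j) l i K y x" for x y
    unfolding arc_form_def by (subst sum.swap) (simp add: algebra_simps)
  then show ?thesis unfolding arc_sum_def by (subst sum.swap) simp
qed

text \<open>The variables \<open>x m\<close> and \<open>y m\<close> do not occur in the form, so their summation gives \<open>q * q\<close>, and
  the larger denominator takes back one factor.\<close>

lemma arc_sum_insert_zero:
  fixes X :: "nat \<Rightarrow> nat \<Rightarrow> 'a::{field,finite}"
  assumes "finite K" and "m \<notin> K" and row: "\<And>k. X m k = 0" and col: "\<And>j. X j m = 0"
  shows "arc_sum \<theta> X i l (insert m K) a = of_nat (card (UNIV :: 'a set)) * arc_sum \<theta> X i l K a"
  unfolding arc_sum_def using assms(1,2)
  by (simp add: sum_PiE_insert2 arc_form_insert row col)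

lemma arc_sum_Un_zero:
  fixes X :: "nat \<Rightarrow> nat \<Rightarrow> 'a::{field,finite}"
  assumes "finite K" and "finite D" and "D \<inter> K = {}"
    and "\<And>d k. d \<in> D \<Longrightarrow> X d k = 0" and "\<And>d j. d \<in> D \<Longrightarrow> X j d = 0"
  shows "arc_sum \<theta> X i l (D \<union> K) a = of_nat (card (UNIV :: 'a set)) ^ card D * arc_sum \<theta> X i l K a"
  using assms(2-5)
proof (induction D rule: finite_induct)
  case (insert d D)
  then have "arc_sum \<theta> X i l (insert d (D \<union> K)) a = of_nat (card (UNIV :: 'a set)) * arc_sum \<theta> X i l (D \<union> K) a"
    using assms(1) by (intro arc_sum_insert_zero) auto
  then show ?case using insert by simp
qed simp

lemma sum_PiE_scale:
  fixes b :: "'a::field" and K :: "'b set"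
  assumes "b \<noteq> 0"
  shows "(\<Sum>x\<in>K \<rightarrow>\<^sub>E UNIV. f (\<lambda>j\<in>K. b * x j)) = (\<Sum>x\<in>K \<rightarrow>\<^sub>E UNIV. f x)"
proof (rule sum.reindex_bij_witness[where i = "\<lambda>x. \<lambda>j\<in>K. x j / b" and j = "\<lambda>x. \<lambda>j\<in>K. b * x j"])
  fix x :: "'b \<Rightarrow> 'a" assume x: "x \<in> K \<rightarrow>\<^sub>E UNIV"
  show "(\<lambda>j\<in>K. (\<lambda>j\<in>K. b * x j) j / b) = x" and "(\<lambda>j\<in>K. b * (\<lambda>j\<in>K. x j / b) j) = x"
    by (rule PiE_ext[OF _ x]; simp add: assms)+
qed simp_all

text \<open>For strictly upper triangular \<open>X\<close>, column \<open>m\<close> vanishes on \<open>insert m K\<close> when \<open>m\<close> is the least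
  index there. The variable \<open>y m\<close> then does
  not occur; its summation cancels the additional factor in the denominator. The terms
  with \<open>x m = 0\<close> form the sum over \<open>K\<close>. In the terms with \<open>x m = b \<noteq> 0\<close>, replacing \<open>x\<close> by \<open>b * x\<close>
  makes \<open>b\<close> a common factor of the form, because the vanishing row \<open>i\<close> leaves no inhomogeneous part:
  \<open>m\<close> takes over the role of \<open>i\<close>, and \<open>a * b\<close> the role of the label.\<close>

lemma arc_sum_insert_row:
  fixes X :: "nat \<Rightarrow> nat \<Rightarrow> 'a::{field,finite}"
  assumes "finite K" and "m \<notin> K" and "a \<noteq> 0"
    and row: "\<And>k. k \<in> insert l (insert m K) \<Longrightarrow> X i k = 0"
    and col: "\<And>j. j \<in> insert m K \<Longrightarrow> X j m = 0"
  shows "arc_sum \<theta> X i l (insert m K) a =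
    arc_sum \<theta> X i l K a + (\<Sum>b\<in>UNIV - {0}. arc_sum \<theta> X m l K b)"
proof -
  let ?q = "of_nat (card (UNIV :: 'a set)) :: complex"
  define F where "F i' c = (\<Sum>x\<in>K \<rightarrow>\<^sub>E UNIV. \<Sum>y\<in>K \<rightarrow>\<^sub>E UNIV. \<theta> (c * arc_form X i' l K x y))" for i' c
  define G where "G b = (\<Sum>x\<in>K \<rightarrow>\<^sub>E UNIV. \<Sum>y\<in>K \<rightarrow>\<^sub>E UNIV.
      \<theta> (a * (arc_form X i l K x y + b * (X m l + (\<Sum>k\<in>K. X m k * y k)))))" for b
  have "(\<Sum>x\<in>insert m K \<rightarrow>\<^sub>E UNIV. \<Sum>y\<in>insert m K \<rightarrow>\<^sub>E UNIV. \<theta> (a * arc_form X i l (insert m K) x y))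
      = ?q * (\<Sum>b\<in>UNIV. G b)"
    unfolding G_def using assms(1,2)
    by (simp add: sum_PiE_insert2 arc_form_insert row col flip: sum_distrib_left)
  also have "(\<Sum>b\<in>UNIV. G b) = G 0 + (\<Sum>b\<in>UNIV - {0}. G b)"
    by (simp add: sum.remove)
  also have "G 0 = F i a" by (simp add: G_def F_def)
  also have "(\<Sum>b\<in>UNIV - {0}. G b) = (\<Sum>b\<in>UNIV - {0}. F m (a * b))"
  proof (intro sum.cong refl)
    fix b :: 'a assume "b \<in> UNIV - {0}"
    then have b: "b \<noteq> 0" by simp
    have "arc_form X i l K (\<lambda>j\<in>K. b * x j) y + b * (X m l + (\<Sum>k\<in>K. X m k * y k)) =
        b * arc_form X m l K x y" for x y
      by (simp add: arc_form_def row sum_distrib_left algebra_simps)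
    then show "G b = F m (a * b)"
      unfolding G_def F_def
      by (subst sum_PiE_scale[OF b, symmetric]) (simp add: mult.assoc)
  qed
  also have "\<dots> = (\<Sum>b\<in>UNIV - {0}. F m b)"
    using assms(3)
    by (intro sum.reindex_bij_witness[where i = "\<lambda>b. b / a" and j = "\<lambda>b. a * b"]) auto
  finally show ?thesis
    using assms(1,2) unfolding arc_sum_def F_def
    by (simp add: add_divide_distrib distrib_left sum_divide_distrib)
qed

text \<open>Adding the elements of \<open>K\<close> in decreasing order makes each of them the least index of the set
  obtained so far. The summand of \<open>j\<close> collects the vectors \<open>x\<close> whose first nonzero position is \<open>j\<close>.\<close>

lemma arc_sum_expand_row:
  fixes X :: "nat \<Rightarrow> nat \<Rightarrow> 'a::{field,finite}"
  assumes "\<theta> 0 = 1" and "a \<noteq> 0" and "finite K"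
    and "\<And>k. k \<in> insert l K \<Longrightarrow> X i k = 0"
    and "\<And>j k. j \<in> K \<Longrightarrow> k \<in> K \<Longrightarrow> k \<le> j \<Longrightarrow> X j k = 0"
  shows "arc_sum \<theta> X i l K a =
    1 + (\<Sum>j\<in>K. \<Sum>b\<in>UNIV - {0}. arc_sum \<theta> X j l {k\<in>K. j < k} b)"
  using assms(3-5)
proof (induction K rule: finite_linorder_min_induct)
  case empty
  then show ?case using assms(1) by (simp add: arc_sum_def arc_form_def)
next
  case (insert m K)
  have m: "m \<notin> K" using insert.hyps by auto
  have "{k \<in> insert m K. m < k} = K" and "\<And>j. j \<in> K \<Longrightarrow> {k \<in> insert m K. j < k} = {k \<in> K. j < k}"
    using insert.hyps by auto
  moreover have "arc_sum \<theta> X i l (insert m K) a =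
      arc_sum \<theta> X i l K a + (\<Sum>b\<in>UNIV - {0}. arc_sum \<theta> X m l K b)"
  proof (rule arc_sum_insert_row)
    show "X i k = 0" if "k \<in> insert l (insert m K)" for k using insert.prems(1) that by blast
    show "X j m = 0" if "j \<in> insert m K" for j
    proof -
      have "m \<le> j" using that insert.hyps(2) by auto
      then show ?thesis using that by (intro insert.prems(2)) simp_all
    qed
  qed (fact insert.hyps m assms)+
  moreover have "arc_sum \<theta> X i l K a =
      1 + (\<Sum>j\<in>K. \<Sum>b\<in>UNIV - {0}. arc_sum \<theta> X j l {k\<in>K. j < k} b)"
    by (rule insert.IH) (use insert.prems in blast)+
  ultimately show ?case using insert.hyps(1) m by (simp add: algebra_simps)
qed

text \<open>The mirror image: the elements of \<open>K\<close> are added in increasing order, and the inductive step is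
  the row step for the transposed array.\<close>

lemma arc_sum_expand_col:
  fixes X :: "nat \<Rightarrow> nat \<Rightarrow> 'a::{field,finite}"
  assumes "\<theta> 0 = 1" and "a \<noteq> 0" and "finite K"
    and "\<And>j. j \<in> insert i K \<Longrightarrow> X j l = 0"
    and "\<And>j k. j \<in> K \<Longrightarrow> k \<in> K \<Longrightarrow> k \<le> j \<Longrightarrow> X j k = 0"
  shows "arc_sum \<theta> X i l K a =
    1 + (\<Sum>k\<in>K. \<Sum>b\<in>UNIV - {0}. arc_sum \<theta> X i k {j\<in>K. j < k} b)"
  using assms(3-5)
proof (induction K rule: finite_linorder_max_induct)
  case empty
  then show ?case using assms(1) by (simp add: arc_sum_def arc_form_def)
next
  case (insert m K)
  have m: "m \<notin> K" using insert.hyps by auto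
  have "{j \<in> insert m K. j < m} = K" and "\<And>k. k \<in> K \<Longrightarrow> {j \<in> insert m K. j < k} = {j \<in> K. j < k}"
    using insert.hyps by auto
  moreover have "arc_sum \<theta> X i l (insert m K) a =
      arc_sum \<theta> X i l K a + (\<Sum>b\<in>UNIV - {0}. arc_sum \<theta> X i m K b)"
    unfolding arc_sum_transpose[of \<theta> X]
  proof (rule arc_sum_insert_row)
    show "X k l = 0" if "k \<in> insert i (insert m K)" for k using insert.prems(1) that by blast
    show "X m k = 0" if "k \<in> insert m K" for k
    proof -
      have "k \<le> m" using that insert.hyps(2) by auto
      then show ?thesis using that by (intro insert.prems(2)) simp_all
    qed
  qed (fact insert.hyps m assms)+
  moreover have "arc_sum \<theta> X i l K a =
      1 + (\<Sum>k\<in>K. \<Sum>b\<in>UNIV - {0}. arc_sum \<theta> X i k {j\<in>K. j < k} b)"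
    by (rule insert.IH) (use insert.prems in blast)+
  ultimately show ?case using insert.hyps(1) m by (simp add: algebra_simps)
qed

section \<open>The orbits of an arc\<close>

lemma entry_mult:
  assumes "A \<in> carrier_mat n n" "B \<in> carrier_mat n n" "i \<in> {1..n}" "j \<in> {1..n}"
  shows "entry (A * B) i j = (\<Sum>k\<in>{1..n}. entry A i k * entry B k j)"
proof -
  have "entry (A * B) i j = (\<Sum>k<n. A $$ (i - 1, k) * B $$ (k, j - 1))"
    using assms unfolding entry_def by (auto simp: scalar_prod_def lessThan_atLeast0)
  also have "\<dots> = (\<Sum>k\<in>{1..n}. entry A i k * entry B k j)"
    unfolding entry_def
    by (intro sum.reindex_bij_witness[where i = "\<lambda>k. k - 1" and j = Suc]) auto
  finally show ?thesis .
qed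

lemma U_entry_diag: "g \<in> carrier (U n S) \<Longrightarrow> i \<in> {1..n} \<Longrightarrow> entry g i i = 1"
  by (simp add: U_def unitriangular_def)

lemma U_entry_nonzero:
  assumes "g \<in> carrier (U n S)" "i \<in> {1..n}" "j \<in> {1..n}" "entry g i j \<noteq> 0" "i \<noteq> j"
  shows "i < j \<and> i \<in> S \<and> j \<in> S"
proof -
  have g: "g \<in> carrier_mat n n" "g - 1\<^sub>m n \<in> nil n S" using assms(1) by (auto simp: mem_U_iff)
  then have "entry (g - 1\<^sub>m n) i j = entry g i j" using assms by (auto simp: entry_def)
  then show ?thesis using g(2) assms unfolding mem_nil_iff by metis
qed

lemma U_mult_nil:
  assumes "g \<in> carrier (U n S)" "X \<in> nil n S"
  shows "g * X \<in> nil n S"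
  unfolding mem_nil_iff
proof (intro conjI ballI impI)
  have c: "g \<in> carrier_mat n n" "X \<in> carrier_mat n n" using assms by (auto simp: mem_U_iff mem_nil_iff)
  then show "g * X \<in> carrier_mat n n" by simp
  fix i j assume ij: "i \<in> {1..n}" "j \<in> {1..n}" "entry (g * X) i j \<noteq> 0"
  then obtain k where k: "k \<in> {1..n}" "entry g i k * entry X k j \<noteq> 0"
    unfolding entry_mult[OF c ij(1,2)] by (meson sum.neutral)
  then have "k < j \<and> k \<in> S \<and> j \<in> S" "i = k \<or> (i < k \<and> i \<in> S)"
    using ij assms U_entry_nonzero[OF assms(1) ij(1) k(1)] unfolding mem_nil_iff by auto
  then show "i < j" "i \<in> S" "j \<in> S" by auto
qed

lemma nil_mult_U:
  assumes "g \<in> carrier (U n S)" "X \<in> nil n S"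
  shows "X * g \<in> nil n S"
  unfolding mem_nil_iff
proof (intro conjI ballI impI)
  have c: "X \<in> carrier_mat n n" "g \<in> carrier_mat n n" using assms by (auto simp: mem_U_iff mem_nil_iff)
  then show "X * g \<in> carrier_mat n n" by simp
  fix i j assume ij: "i \<in> {1..n}" "j \<in> {1..n}" "entry (X * g) i j \<noteq> 0"
  then obtain k where k: "k \<in> {1..n}" "entry X i k * entry g k j \<noteq> 0"
    unfolding entry_mult[OF c ij(1,2)] by (meson sum.neutral)
  then have "i < k \<and> i \<in> S \<and> k \<in> S" "k = j \<or> (k < j \<and> j \<in> S)"
    using ij assms U_entry_nonzero[OF assms(1) k(1) ij(2)] unfolding mem_nil_iff by auto
  then show "i < j" "i \<in> S" "j \<in> S" by auto
qed

definition arc_functional ::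
    "nat \<Rightarrow> nat set \<Rightarrow> nat \<Rightarrow> nat \<Rightarrow> 'a::field \<Rightarrow> (nat \<Rightarrow> 'a) \<Rightarrow> (nat \<Rightarrow> 'a) \<Rightarrow> 'a mat \<Rightarrow> 'a" where
  "arc_functional n S i l a x y =
     (\<lambda>X\<in>nil n S. a * arc_form (entry X) i l {k\<in>S. i < k \<and> k < l} x y)"

text \<open>Triangularity restricts the sum over all \<open>j\<close> and \<open>k\<close> to \<open>i \<le> j < k \<le> l\<close>; the unit diagonals of
  \<open>g\<close> and \<open>h\<close> supply the coefficients at \<open>j = i\<close> and \<open>k = l\<close>.\<close>

lemma entry_U_nil_U:
  assumes g: "g \<in> carrier (U n S)" and h: "h \<in> carrier (U n S)" and X: "X \<in> nil n S"
    and S: "S \<subseteq> {1..n}" and il: "1 \<le> i" "i < l" "l \<le> n"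
  shows "entry (g * (X * h)) i l =
    arc_form (entry X) i l {k\<in>S. i < k \<and> k < l} (entry g i) (\<lambda>k. entry h k l)"
proof -
  let ?K = "{k\<in>S. i < k \<and> k < l}"
  have c: "g \<in> carrier_mat n n" "h \<in> carrier_mat n n" "X \<in> carrier_mat n n" "X * h \<in> carrier_mat n n"
    using g h X nil_mult_U[OF h X] by (auto simp: mem_U_iff mem_nil_iff)
  have r: "i \<in> {1..n}" "l \<in> {1..n}" using il by auto
  have K: "?K \<subseteq> {1..n}" "finite ?K" using S by (auto intro: finite_subset)
  have X0: "entry X j k = 0" if "j \<in> {1..n}" "k \<in> {1..n}" "\<not> (j < k \<and> j \<in> S \<and> k \<in> S)" for j k
    using X that unfolding mem_nil_iff by blast
  have Xh: "entry (X * h) j l = entry X j l + (\<Sum>k\<in>?K. entry X j k * entry h k l)"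
    if j: "j \<in> {1..n}" "i \<le> j" for j
  proof -
    have "entry (X * h) j l = (\<Sum>k\<in>insert l ?K. entry X j k * entry h k l)"
      unfolding entry_mult[OF c(3,2) j(1) r(2)]
    proof (rule sum.mono_neutral_right)
      show "\<forall>k\<in>{1..n} - insert l ?K. entry X j k * entry h k l = 0"
      proof
        fix k assume k: "k \<in> {1..n} - insert l ?K"
        then show "entry X j k * entry h k l = 0"
          using X0[OF j(1), of k] U_entry_nonzero[OF h _ r(2), of k] j by fastforce
      qed
    qed (use r K in auto)
    then show ?thesis using K U_entry_diag[OF h r(2)] by simp
  qed
  have "entry (g * (X * h)) i l = (\<Sum>j\<in>insert i ?K. entry g i j * entry (X * h) j l)"
    unfolding entry_mult[OF c(1,4) r]
  proof (rule sum.mono_neutral_right)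
    show "\<forall>j\<in>{1..n} - insert i ?K. entry g i j * entry (X * h) j l = 0"
    proof
      fix j assume j: "j \<in> {1..n} - insert i ?K"
      have "entry (X * h) j l \<noteq> 0 \<longrightarrow> j < l \<and> j \<in> S"
        using nil_mult_U[OF h X] j r unfolding mem_nil_iff by blast
      then show "entry g i j * entry (X * h) j l = 0"
        using U_entry_nonzero[OF g r(1), of j] j by auto
    qed
  qed (use r K in auto)
  also have "\<dots> = entry (X * h) i l + (\<Sum>j\<in>?K. entry g i j * entry (X * h) j l)"
    using K U_entry_diag[OF g r(1)] by simp
  also have "(\<Sum>j\<in>?K. entry g i j * entry (X * h) j l) =
      (\<Sum>j\<in>?K. entry g i j * (entry X j l + (\<Sum>k\<in>?K. entry X j k * entry h k l)))"
    using K(1) by (intro sum.cong refl) (subst Xh, auto)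
  finally show ?thesis
    using r by (simp add: Xh arc_form_def distrib_left sum.distrib sum_distrib_left mult.assoc)
qed

text \<open>The action of \<open>g\<close> multiplies the argument by the inverse of \<open>g\<close>. Stating the orbit map for
  inverses, which run through the whole group as well, expresses it by entries of \<open>g\<close> and \<open>h\<close>.\<close>

lemma act_arc:
  fixes g :: "'a::{field,finite} mat"
  assumes g: "g \<in> carrier (U n S)" and h: "h \<in> carrier (U n S)"
    and S: "S \<subseteq> {1..n}" and il: "1 \<le> i" "i < l" "l \<le> n"
  shows "right_act n S (left_act n S (inv\<^bsub>U n S\<^esub> g) (arc n S i a l)) (inv\<^bsub>U n S\<^esub> h) =
    arc_functional n S i l a (entry g i) (\<lambda>k. entry h k l)"
proof -
  interpret group "U n S :: 'a mat monoid" by (rule U_group)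
  show ?thesis
    unfolding right_act_def left_act_def arc_def arc_functional_def
    using g h by (auto simp: fun_eq_iff restrict_def nil_mult_U U_mult_nil entry_U_nil_U[OF g h _ S il])
qed

lemma arc_functional_cong:
  assumes "\<And>k. k \<in> S \<Longrightarrow> i < k \<Longrightarrow> k < l \<Longrightarrow> x k = x' k"
    and "\<And>k. k \<in> S \<Longrightarrow> i < k \<Longrightarrow> k < l \<Longrightarrow> y k = y' k"
  shows "arc_functional n S i l a x y = arc_functional n S i l a x' y'"
  unfolding arc_functional_def arc_form_def
  by (intro restrict_ext arg_cong2[where f = "(+)"] arg_cong2[where f = "(*)"] sum.cong refl)
    (use assms in auto)

lemma exists_U_row:
  fixes x :: "nat \<Rightarrow> 'a::field"
  assumes "S \<subseteq> {1..n}" "i \<in> S"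
  obtains g where "g \<in> carrier (U n S)" "\<And>k. k \<in> S \<Longrightarrow> i < k \<Longrightarrow> entry g i k = x k"
proof -
  define g where "g = mat n n (\<lambda>(r, c). if r = c then 1
      else if Suc r = i \<and> i < Suc c \<and> Suc c \<in> S then x (Suc c) else 0)"
  have "g \<in> carrier (U n S)"
    using assms by (auto simp: mem_U_iff mem_nil_iff g_def entry_def split: if_splits)
  moreover have "entry g i k = x k" if "k \<in> S" "i < k" for k
  proof -
    have "1 \<le> i" "i \<le> n" "k \<le> n" "1 \<le> k" using that assms by auto
    then show ?thesis using that by (simp add: g_def entry_def)
  qed
  ultimately show ?thesis using that by blast
qed

lemma exists_U_col:
  fixes y :: "nat \<Rightarrow> 'a::field"
  assumes "S \<subseteq> {1..n}" "l \<in> S"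
  obtains g where "g \<in> carrier (U n S)" "\<And>k. k \<in> S \<Longrightarrow> k < l \<Longrightarrow> entry g k l = y k"
proof -
  define g where "g = mat n n (\<lambda>(r, c). if r = c then 1
      else if Suc c = l \<and> Suc r < l \<and> Suc r \<in> S then y (Suc r) else 0)"
  have "g \<in> carrier (U n S)"
    using assms by (auto simp: mem_U_iff mem_nil_iff g_def entry_def split: if_splits)
  moreover have "entry g k l = y k" if "k \<in> S" "k < l" for k
  proof -
    have "1 \<le> l" "l \<le> n" "k \<le> n" "1 \<le> k" using that assms by auto
    then show ?thesis using that by (simp add: g_def entry_def)
  qed
  ultimately show ?thesis using that by blast
qed

text \<open>This is where \<open>i\<close> and \<open>l\<close> must belong to \<open>S\<close>: only then does the group contain matrices with
  arbitrary entries in row \<open>i\<close> and column \<open>l\<close> at the labels of \<open>K\<close>.\<close>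

lemma two_sided_orbit_arc:
  fixes a :: "'a::{field,finite}"
  assumes S: "S \<subseteq> {1..n}" and il: "i \<in> S" "l \<in> S" "i < l"
  defines "K \<equiv> {k\<in>S. i < k \<and> k < l}"
  shows "two_sided_orbit n S (arc n S i a l) =
    (\<lambda>(x, y). arc_functional n S i l a x y) ` ((K \<rightarrow>\<^sub>E UNIV) \<times> (K \<rightarrow>\<^sub>E UNIV))" (is "?L = ?R")
proof -
  interpret group "U n S :: 'a mat monoid" by (rule U_group)
  have il': "1 \<le> i" "l \<le> n" using S il by auto
  note act = act_arc[OF _ _ S il'(1) il(3) il'(2)]
  show ?thesis
  proof (intro subset_antisym subsetI)
    fix \<mu> assume "\<mu> \<in> ?L"
    then obtain g h where gh: "g \<in> carrier (U n S)" "h \<in> carrier (U n S)"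
      and \<mu>: "\<mu> = right_act n S (left_act n S g (arc n S i a l)) h"
      unfolding two_sided_orbit_def by blast
    have "\<mu> = arc_functional n S i l a (entry (inv\<^bsub>U n S\<^esub> g) i) (\<lambda>k. entry (inv\<^bsub>U n S\<^esub> h) k l)"
      using act[of "inv\<^bsub>U n S\<^esub> g" "inv\<^bsub>U n S\<^esub> h" a] gh unfolding \<mu> by simp
    also have "\<dots> = arc_functional n S i l a (restrict (entry (inv\<^bsub>U n S\<^esub> g) i) K)
        (restrict (\<lambda>k. entry (inv\<^bsub>U n S\<^esub> h) k l) K)"
      by (intro arc_functional_cong) (auto simp: K_def)
    finally show "\<mu> \<in> ?R" by auto
  next
    fix \<mu> assume "\<mu> \<in> ?R"
    then obtain x y where \<mu>: "\<mu> = arc_functional n S i l a x y" by auto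
    obtain g where g: "g \<in> carrier (U n S)" "\<And>k. k \<in> S \<Longrightarrow> i < k \<Longrightarrow> entry g i k = x k"
      using exists_U_row[OF S il(1)] by metis
    obtain h where h: "h \<in> carrier (U n S)" "\<And>k. k \<in> S \<Longrightarrow> k < l \<Longrightarrow> entry h k l = y k"
      using exists_U_col[OF S il(2)] by metis
    have "\<mu> = right_act n S (left_act n S (inv\<^bsub>U n S\<^esub> g) (arc n S i a l)) (inv\<^bsub>U n S\<^esub> h)"
      unfolding \<mu> act[OF g(1) h(1)] using g h by (intro arc_functional_cong) auto
    then show "\<mu> \<in> ?L" using g h unfolding two_sided_orbit_def by blast
  qed
qed

lemma right_orbit_arc:
  fixes a :: "'a::{field,finite}"
  assumes S: "S \<subseteq> {1..n}" and il: "i \<in> S" "l \<in> S" "i < l"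
  defines "K \<equiv> {k\<in>S. i < k \<and> k < l}"
  shows "right_orbit n S (arc n S i a l) = arc_functional n S i l a (\<lambda>k\<in>K. 0) ` (K \<rightarrow>\<^sub>E UNIV)"
    (is "?L = ?R")
proof -
  interpret group "U n S :: 'a mat monoid" by (rule U_group)
  have il': "1 \<le> i" "l \<le> n" using S il by auto
  have inv_one: "inv\<^bsub>U n S\<^esub> (1\<^sub>m n :: 'a mat) = 1\<^sub>m n" and one: "(1\<^sub>m n :: 'a mat) \<in> carrier (U n S)"
    using inv_one one_closed by (simp_all add: U_def)
  have "left_act n S (inv\<^bsub>U n S\<^esub> 1\<^sub>m n) (arc n S i a l) = arc n S i a l"
    unfolding left_act_def inv_one arc_def
  proof (rule restrict_ext)
    fix X :: "'a mat" assume X: "X \<in> nil n S"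
    then have "X \<in> carrier_mat n n" by (simp add: mem_nil_iff)
    then have "1\<^sub>m n * X = X" by simp
    then show "(\<lambda>X\<in>nil n S. a * entry X i l) (1\<^sub>m n * X) = a * entry X i l" using X by simp
  qed
  moreover have "arc_functional n S i l a (entry (1\<^sub>m n) i) y = arc_functional n S i l a (\<lambda>k\<in>K. 0) y" for y
    using S il' il by (intro arc_functional_cong) (auto simp: K_def entry_def)
  ultimately have act: "right_act n S (arc n S i a l) (inv\<^bsub>U n S\<^esub> h) =
      arc_functional n S i l a (\<lambda>k\<in>K. 0) (\<lambda>k. entry h k l)" if "h \<in> carrier (U n S)" for h
    using act_arc[OF one that S il'(1) il(3) il'(2), of a] by simp
  show ?thesis
  proof (intro subset_antisym subsetI)
    fix \<mu> assume "\<mu> \<in> ?L"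
    then obtain h where h: "h \<in> carrier (U n S)" and \<mu>: "\<mu> = right_act n S (arc n S i a l) h"
      unfolding right_orbit_def by blast
    have "\<mu> = arc_functional n S i l a (\<lambda>k\<in>K. 0) (\<lambda>k. entry (inv\<^bsub>U n S\<^esub> h) k l)"
      using act[of "inv\<^bsub>U n S\<^esub> h"] h unfolding \<mu> by simp
    also have "\<dots> = arc_functional n S i l a (\<lambda>k\<in>K. 0) (restrict (\<lambda>k. entry (inv\<^bsub>U n S\<^esub> h) k l) K)"
      by (intro arc_functional_cong) (auto simp: K_def)
    finally show "\<mu> \<in> ?R" by auto
  next
    fix \<mu> assume "\<mu> \<in> ?R"
    then obtain y where \<mu>: "\<mu> = arc_functional n S i l a (\<lambda>k\<in>K. 0) y" by auto
    obtain h where h: "h \<in> carrier (U n S)" "\<And>k. k \<in> S \<Longrightarrow> k < l \<Longrightarrow> entry h k l = y k"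
      using exists_U_col[OF S il(2)] by metis
    have "\<mu> = right_act n S (arc n S i a l) (inv\<^bsub>U n S\<^esub> h)"
      unfolding \<mu> act[OF h(1)] using h by (intro arc_functional_cong) auto
    then show "\<mu> \<in> ?L" using h unfolding right_orbit_def by blast
  qed
qed

lemma exists_nil_elementary:
  assumes "S \<subseteq> {1..n}" "j \<in> S" "k \<in> S" "j < k"
  obtains X :: "'a::field mat" where "X \<in> nil n S"
    "\<And>r c. r \<in> S \<Longrightarrow> c \<in> S \<Longrightarrow> entry X r c = (if r = j \<and> c = k then 1 else 0)"
proof -
  define X :: "'a mat" where "X = mat n n (\<lambda>(r, c). if Suc r = j \<and> Suc c = k then 1 else 0)"
  have e: "entry X r c = (if r = j \<and> c = k then 1 else 0)" if "r \<in> {1..n}" "c \<in> {1..n}" for r c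
    using that by (auto simp: X_def entry_def)
  have "X \<in> nil n S" using assms by (auto simp: mem_nil_iff e) (simp add: X_def)
  then show ?thesis using that e assms(1) by blast
qed

text \<open>The elementary matrix at \<open>(j, l)\<close> reads off \<open>x j\<close>, and the one at \<open>(i, k)\<close> reads off \<open>y k\<close>.\<close>

lemma inj_on_arc_functional:
  fixes a :: "'a::field"
  assumes S: "S \<subseteq> {1..n}" and il: "i \<in> S" "l \<in> S" "i < l" and a: "a \<noteq> 0"
  defines "K \<equiv> {k\<in>S. i < k \<and> k < l}"
  shows "inj_on (\<lambda>(x, y). arc_functional n S i l a x y) ((K \<rightarrow>\<^sub>E UNIV) \<times> (K \<rightarrow>\<^sub>E UNIV))"
proof -
  have finK: "finite K" using S by (auto simp: K_def intro: finite_subset)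
  have row: "\<exists>X\<in>nil n S. \<forall>x y. arc_functional n S i l a x y X = a * x j" if j: "j \<in> K" for j
  proof -
    obtain X :: "'a mat" where X: "X \<in> nil n S"
      "\<And>r c. r \<in> S \<Longrightarrow> c \<in> S \<Longrightarrow> entry X r c = (if r = j \<and> c = l then 1 else 0)"
      using exists_nil_elementary[OF S, of j l] j il unfolding K_def by blast
    have "arc_form (entry X) i l K x y = x j" for x y
    proof -
      have "(\<Sum>r\<in>K. x r * entry X r l) = (\<Sum>r\<in>K. if r = j then x r else 0)"
        using il by (intro sum.cong) (auto simp: K_def X)
      also have "\<dots> = x j" using j finK by simp
      finally show ?thesis using j il by (simp add: arc_form_def K_def X)
    qed
    then show ?thesis using X(1) unfolding arc_functional_def K_def by auto
  qed
  have col: "\<exists>X\<in>nil n S. \<forall>x y. arc_functional n S i l a x y X = a * y k" if k: "k \<in> K" for k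
  proof -
    obtain X :: "'a mat" where X: "X \<in> nil n S"
      "\<And>r c. r \<in> S \<Longrightarrow> c \<in> S \<Longrightarrow> entry X r c = (if r = i \<and> c = k then 1 else 0)"
      using exists_nil_elementary[OF S, of i k] k il unfolding K_def by blast
    have "arc_form (entry X) i l K x y = y k" for x y
    proof -
      have "(\<Sum>c\<in>K. entry X i c * y c) = (\<Sum>c\<in>K. if c = k then y c else 0)"
        using il by (intro sum.cong) (auto simp: K_def X)
      also have "\<dots> = y k" using k finK by simp
      finally show ?thesis using k il by (simp add: arc_form_def K_def X)
    qed
    then show ?thesis using X(1) unfolding arc_functional_def K_def by auto
  qed
  show ?thesis
  proof (intro inj_onI, clarify, intro conjI)
    fix x y x' y' assume K: "x \<in> K \<rightarrow>\<^sub>E UNIV" "x' \<in> K \<rightarrow>\<^sub>E UNIV" "y \<in> K \<rightarrow>\<^sub>E UNIV" "y' \<in> K \<rightarrow>\<^sub>E UNIV"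
      and eq: "arc_functional n S i l a x y = arc_functional n S i l a x' y'"
    have "x j = x' j" if "j \<in> K" for j using row[OF that] eq a by (metis mult_cancel_left)
    then show "x = x'" using K by (intro PiE_ext)
    have "y j = y' j" if "j \<in> K" for j using col[OF that] eq a by (metis mult_cancel_left)
    then show "y = y'" using K by (intro PiE_ext)
  qed
qed

text \<open>The two-sided orbit has \<open>q ^ (2 * |K|)\<close> elements and the right orbit has \<open>q ^ |K|\<close>.\<close>

lemma supercharacter_arc:
  fixes a :: "'a::{field,finite}"
  assumes S: "S \<subseteq> {1..n}" and il: "i \<in> S" "l \<in> S" "i < l" and a: "a \<noteq> 0"
    and u: "u \<in> carrier (U n S)"
  shows "supercharacter \<theta> n S (arc n S i a l) u =
    arc_sum \<theta> (entry (u - 1\<^sub>m n)) i l {k\<in>S. i < k \<and> k < l} a"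
proof -
  define K where "K = {k\<in>S. i < k \<and> k < l}"
  have finK: "finite K" using S by (auto simp: K_def intro: finite_subset)
  note inj = inj_on_arc_functional[OF S il a, folded K_def]
  have nil: "u - 1\<^sub>m n \<in> nil n S" using u by (simp add: mem_U_iff)
  have two: "two_sided_orbit n S (arc n S i a l) =
      (\<lambda>(x, y). arc_functional n S i l a x y) ` ((K \<rightarrow>\<^sub>E UNIV) \<times> (K \<rightarrow>\<^sub>E UNIV))"
    using two_sided_orbit_arc[OF S il] unfolding K_def .
  have "card (two_sided_orbit n S (arc n S i a l)) = card (UNIV :: 'a set) ^ card K * card (UNIV :: 'a set) ^ card K"
    unfolding two card_image[OF inj] by (simp add: card_cartesian_product card_PiE finK)
  moreover have "card (right_orbit n S (arc n S i a l)) = card (UNIV :: 'a set) ^ card K"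
  proof -
    have "inj_on (arc_functional n S i l a (\<lambda>k\<in>K. 0)) (K \<rightarrow>\<^sub>E UNIV)"
    proof (rule inj_onI)
      fix y y' assume "y \<in> K \<rightarrow>\<^sub>E UNIV" "y' \<in> K \<rightarrow>\<^sub>E UNIV"
        "arc_functional n S i l a (\<lambda>k\<in>K. 0) y = arc_functional n S i l a (\<lambda>k\<in>K. 0) y'"
      then show "y = y'" using inj_onD[OF inj, of "(\<lambda>k\<in>K. 0, y)" "(\<lambda>k\<in>K. 0, y')"] by auto
    qed
    then show ?thesis
      unfolding right_orbit_arc[OF S il, folded K_def] by (simp add: card_image card_PiE finK)
  qed
  moreover have "(\<Sum>\<mu>\<in>two_sided_orbit n S (arc n S i a l). \<theta> (\<mu> (u - 1\<^sub>m n))) =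
      (\<Sum>x\<in>K \<rightarrow>\<^sub>E UNIV. \<Sum>y\<in>K \<rightarrow>\<^sub>E UNIV. \<theta> (a * arc_form (entry (u - 1\<^sub>m n)) i l K x y))"
    unfolding two sum.reindex[OF inj] using nil
    by (simp add: sum.cartesian_product case_prod_unfold arc_functional_def K_def)
  ultimately show ?thesis
    using u by (simp add: supercharacter_def arc_sum_def K_def[symmetric])
qed

section \<open>Restriction\<close>

text \<open>The array \<open>X\<close> is \<open>u - 1\<close> cut off outside \<open>S\<close>. The two agree on labels in \<open>{1..n}\<close>, but
  \<open>entry\<close> has unspecified values at other labels, while \<open>X\<close> vanishes in every row and column
  outside \<open>S\<close>.\<close>

lemma supercharacter_arc_restrict:
  fixes a :: "'a::{field,finite}"
  assumes S: "S \<subseteq> {1..n}" and il: "1 \<le> i" "i < l" "l \<le> n" and a: "a \<noteq> 0"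
    and u: "u \<in> carrier (U n S)"
    and X: "\<And>j k. X j k = (if j \<in> S \<and> k \<in> S then entry (u - 1\<^sub>m n) j k else 0)"
  shows "supercharacter \<theta> n {1..n} (arc n {1..n} i a l) u =
    of_nat (card (UNIV :: 'a set)) ^ card {k. i < k \<and> k < l \<and> k \<notin> S} *
    arc_sum \<theta> X i l {k\<in>S. i < k \<and> k < l} a"
proof -
  let ?K = "{k\<in>S. i < k \<and> k < l}" and ?D = "{k. i < k \<and> k < l \<and> k \<notin> S}"
  have un: "u \<in> carrier (U n {1..n})" using u by (auto simp: U_def)
  have nil: "u - 1\<^sub>m n \<in> nil n S" using u by (simp add: mem_U_iff)
  have Xe: "X j k = entry (u - 1\<^sub>m n) j k" if "j \<in> {1..n}" "k \<in> {1..n}" for j k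
  proof -
    have "entry (u - 1\<^sub>m n) j k = 0" if "\<not> (j \<in> S \<and> k \<in> S)"
      using nil that \<open>j \<in> {1..n}\<close> \<open>k \<in> {1..n}\<close> unfolding mem_nil_iff by blast
    then show ?thesis by (auto simp: X)
  qed
  have split: "{k\<in>{1..n}. i < k \<and> k < l} = ?D \<union> ?K" using il by auto
  have r: "i \<in> {1..n}" "l \<in> {1..n}" using il by auto
  have sub: "?D \<union> ?K \<subseteq> {1..n}" using split by blast
  have fin: "finite ?K" "finite ?D" using S by (auto intro: finite_subset)
  have "supercharacter \<theta> n {1..n} (arc n {1..n} i a l) u =
      arc_sum \<theta> (entry (u - 1\<^sub>m n)) i l (?D \<union> ?K) a"
    unfolding split[symmetric] using il un a by (intro supercharacter_arc) auto
  also have "\<dots> = arc_sum \<theta> X i l (?D \<union> ?K) a"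
  proof -
    have "arc_form (entry (u - 1\<^sub>m n)) i l (?D \<union> ?K) x y = arc_form X i l (?D \<union> ?K) x y" for x y
      unfolding arc_form_def using sub r
      by (intro arg_cong2[where f = "(+)"] sum.cong refl) (auto simp: Xe subset_iff)
    then show ?thesis by (simp add: arc_sum_def)
  qed
  also have "\<dots> = of_nat (card (UNIV :: 'a set)) ^ card ?D * arc_sum \<theta> X i l ?K a"
    using fin by (intro arc_sum_Un_zero) (auto simp: X)
  finally show ?thesis .
qed

theorem theorem4p5:
  fixes \<theta> :: "'a::{field,finite} \<Rightarrow> complex"
    and q n i l :: nat and S :: "nat set" and a :: 'a
  assumes "card (UNIV :: 'a set) = q"
    and "nontrivial_additive_character \<theta>"
    and "S \<subseteq> {1..n}"
    and "1 \<le> i" and "i < l" and "l \<le> n" and "a \<noteq> 0"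
  shows
    "(i \<in> S \<and> l \<in> S \<longrightarrow>
        restrict (supercharacter \<theta> n {1..n} (arc n {1..n} i a l)) (carrier (U n S)) =
        (\<lambda>u\<in>carrier (U n S).
           of_nat q ^ card {k. i < k \<and> k < l \<and> k \<notin> S} * supercharacter \<theta> n S (arc n S i a l) u)) \<and>
     (i \<notin> S \<and> l \<in> S \<longrightarrow>
        restrict (supercharacter \<theta> n {1..n} (arc n {1..n} i a l)) (carrier (U n S)) =
        (\<lambda>u\<in>carrier (U n S).
           of_nat q ^ card {k. i < k \<and> k < l \<and> k \<notin> S} *
           (1 + (\<Sum>j\<in>{j\<in>S. i < j \<and> j < l}. \<Sum>b\<in>UNIV - {0}.
                   supercharacter \<theta> n S (arc n S j b l) u)))) \<and>
     (i \<in> S \<and> l \<notin> S \<longrightarrow>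
        restrict (supercharacter \<theta> n {1..n} (arc n {1..n} i a l)) (carrier (U n S)) =
        (\<lambda>u\<in>carrier (U n S).
           of_nat q ^ card {k. i < k \<and> k < l \<and> k \<notin> S} *
           (1 + (\<Sum>k\<in>{k\<in>S. i < k \<and> k < l}. \<Sum>b\<in>UNIV - {0}.
                   supercharacter \<theta> n S (arc n S i b k) u)))) \<and>
     (i \<notin> S \<and> l \<notin> S \<longrightarrow>
        restrict (supercharacter \<theta> n {1..n} (arc n {1..n} i a l)) (carrier (U n S)) =
        (\<lambda>u\<in>carrier (U n S).
           of_nat q ^ card {k. i < k \<and> k < l \<and> k \<notin> S} *
           ((of_nat (card (S \<inter> {i..l})) * (of_nat q - 1) + 1) * 1 +
            (of_nat q - 1) *
            (\<Sum>(j, k)\<in>{(j, k). j \<in> S \<and> k \<in> S \<and> i < j \<and> j < k \<and> k < l}. \<Sum>c\<in>UNIV - {0}.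
               supercharacter \<theta> n S (arc n S j c k) u))))"
proof -
  have "\<theta> (0 + 0) = \<theta> 0 * \<theta> 0" "\<theta> 0 \<noteq> 0"
    using assms(2) unfolding nontrivial_additive_character_def by blast+
  then have \<theta>0: "\<theta> 0 = 1" by simp
  define K where "K = {k\<in>S. i < k \<and> k < l}"
  have finK: "finite K" by (simp add: K_def)
  \<comment> \<open>Total vanishing outside \<open>S\<close> makes row \<open>i\<close> or column \<open>l\<close> zero when the endpoint is not in \<open>S\<close>.\<close>
  define X where "X u j k = (if j \<in> S \<and> k \<in> S then entry (u - 1\<^sub>m n) j k else 0)"
    for u :: "'a mat" and j k
  have res: "supercharacter \<theta> n {1..n} (arc n {1..n} i a l) u =
      of_nat q ^ card {k. i < k \<and> k < l \<and> k \<notin> S} * arc_sum \<theta> (X u) i l K a"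
    if "u \<in> carrier (U n S)" for u
    unfolding K_def assms(1)[symmetric]
    by (intro supercharacter_arc_restrict assms that) (simp add: X_def)
  have chi: "supercharacter \<theta> n S (arc n S j b k) u = arc_sum \<theta> (X u) j k {m\<in>S. j < m \<and> m < k} b"
    if "j \<in> S" "k \<in> S" "j < k" "b \<noteq> 0" "u \<in> carrier (U n S)" for j k b u
  proof -
    have "arc_form (entry (u - 1\<^sub>m n)) j k {m\<in>S. j < m \<and> m < k} =
        arc_form (X u) j k {m\<in>S. j < m \<and> m < k}"
      using that by (simp add: arc_form_def X_def fun_eq_iff)
    then show ?thesis using supercharacter_arc[OF assms(3) that, of \<theta>] by (simp add: arc_sum_def)
  qed
  have upper: "X u j k = 0" if "k \<le> j" "u \<in> carrier (U n S)" for u j k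
  proof (rule ccontr)
    assume nz: "X u j k \<noteq> 0"
    then have jk: "j \<in> S" "k \<in> S" "entry (u - 1\<^sub>m n) j k \<noteq> 0"
      by (auto simp: X_def split: if_splits)
    moreover have "u - 1\<^sub>m n \<in> nil n S" using that(2) by (simp add: mem_U_iff)
    ultimately show False using that(1) assms(3) unfolding mem_nil_iff by fastforce
  qed
  have row: "arc_sum \<theta> (X u) i l K a =
      1 + (\<Sum>j\<in>K. \<Sum>b\<in>UNIV - {0}. arc_sum \<theta> (X u) j l {k\<in>K. j < k} b)"
    if "i \<notin> S" "u \<in> carrier (U n S)" for u
    using that by (intro arc_sum_expand_row \<theta>0 assms(7) finK) (auto simp: upper, auto simp: X_def)
  have col: "arc_sum \<theta> (X u) j l L b =
      1 + (\<Sum>k\<in>L. \<Sum>c\<in>UNIV - {0}. arc_sum \<theta> (X u) j k {m\<in>L. m < k} c)"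
    if "l \<notin> S" "u \<in> carrier (U n S)" "b \<noteq> 0" "finite L" for u j L b
    using that by (intro arc_sum_expand_col \<theta>0) (auto simp: upper, auto simp: X_def)
  have K_above: "{k\<in>K. j < k} = {k\<in>S. j < k \<and> k < l}" if "j \<in> K" for j
    using that by (auto simp: K_def)
  have K_below: "{j\<in>K. j < k} = {j\<in>S. i < j \<and> j < k}" if "k \<in> K" for k
    using that by (auto simp: K_def)
  \<comment> \<open>The row expansion yields arcs that still end at \<open>l\<close>, outside \<open>S\<close>; the column expansion
    is applied to each of them.\<close>
  have both: "arc_sum \<theta> (X u) i l K a = (of_nat (card (S \<inter> {i..l})) * (of_nat q - 1) + 1) * 1 +
      (of_nat q - 1) *
      (\<Sum>(j, k)\<in>{(j, k). j \<in> S \<and> k \<in> S \<and> i < j \<and> j < k \<and> k < l}. \<Sum>c\<in>UNIV - {0}.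
         supercharacter \<theta> n S (arc n S j c k) u)"
    if nS: "i \<notin> S" "l \<notin> S" and u: "u \<in> carrier (U n S)" for u
  proof -
    let ?chi = "\<lambda>j k. \<Sum>c\<in>UNIV - {0}. supercharacter \<theta> n S (arc n S j c k) u"
    have "K = S \<inter> {i..l}" using nS by (auto simp: K_def le_less)
    then have cK: "card (S \<inter> {i..l}) = card K" by simp
    have "1 \<le> q" using assms(1) finite_UNIV_card_ge_0[where 'a = 'a] by simp
    then have q: "of_nat (card (UNIV - {0 :: 'a})) = (of_nat q - 1 :: complex)"
      using assms(1) by (simp add: card_Diff_singleton of_nat_diff)
    have inner: "arc_sum \<theta> (X u) j l {k\<in>K. j < k} b = 1 + (\<Sum>k\<in>{k\<in>K. j < k}. ?chi j k)"
      if j: "j \<in> K" and b: "b \<in> UNIV - {0}" for j b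
    proof -
      have "{m \<in> {k\<in>K. j < k}. m < k} = {m\<in>S. j < m \<and> m < k}" if "k \<in> K" for k
        using that j by (auto simp: K_def)
      then have "(\<Sum>c\<in>UNIV - {0}. arc_sum \<theta> (X u) j k {m \<in> {k\<in>K. j < k}. m < k} c) = ?chi j k"
        if "k \<in> {k\<in>K. j < k}" for k
        using that j u by (intro sum.cong refl) (subst chi, auto simp: K_def)
      then show ?thesis using col[OF nS(2) u, of b "{k\<in>K. j < k}" j] b finK by simp
    qed
    have "arc_sum \<theta> (X u) i l K a =
        1 + (\<Sum>j\<in>K. \<Sum>b\<in>UNIV - {0 :: 'a}. 1 + (\<Sum>k\<in>{k\<in>K. j < k}. ?chi j k))"
      unfolding row[OF nS(1) u] by (intro arg_cong2[where f = "(+)"] sum.cong refl inner)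
    also have "\<dots> = 1 + of_nat (card K) * (of_nat q - 1) +
        (of_nat q - 1) * (\<Sum>j\<in>K. \<Sum>k\<in>{k\<in>K. j < k}. ?chi j k)"
      unfolding sum_constant q distrib_left sum.distrib by (simp flip: sum_distrib_left)
    also have "(\<Sum>j\<in>K. \<Sum>k\<in>{k\<in>K. j < k}. ?chi j k) =
        (\<Sum>(j, k)\<in>{(j, k). j \<in> S \<and> k \<in> S \<and> i < j \<and> j < k \<and> k < l}. ?chi j k)"
      using finK by (subst sum.Sigma) (auto simp: K_def intro!: sum.cong)
    finally show ?thesis by (simp add: cK algebra_simps)
  qed
  have case1: "arc_sum \<theta> (X u) i l K a = supercharacter \<theta> n S (arc n S i a l) u"
    if "i \<in> S" "l \<in> S" "u \<in> carrier (U n S)" for u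
    using that chi assms by (simp add: K_def)
  have case2: "arc_sum \<theta> (X u) i l K a = 1 + (\<Sum>j\<in>{j\<in>S. i < j \<and> j < l}. \<Sum>b\<in>UNIV - {0}.
      supercharacter \<theta> n S (arc n S j b l) u)"
    if "i \<notin> S" "l \<in> S" "u \<in> carrier (U n S)" for u
    unfolding row[OF that(1,3)] K_def[symmetric]
    using that by (intro arg_cong2[where f = "(+)"] sum.cong refl)
      (subst chi, auto simp: K_above, auto simp: K_def)
  have case3: "arc_sum \<theta> (X u) i l K a = 1 + (\<Sum>k\<in>{k\<in>S. i < k \<and> k < l}. \<Sum>b\<in>UNIV - {0}.
      supercharacter \<theta> n S (arc n S i b k) u)"
    if "i \<in> S" "l \<notin> S" "u \<in> carrier (U n S)" for u
    unfolding col[OF that(2,3) assms(7) finK] K_def[symmetric]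
    using that by (intro arg_cong2[where f = "(+)"] sum.cong refl)
      (subst chi, auto simp: K_below, auto simp: K_def)
  show ?thesis
    by (intro conjI impI restrict_ext; elim conjE; simp only: res case1 case2 case3 both not_False_eq_True)
qed

end
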